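(* Let $X$ be a real 2-uniformly convex and uniformly smooth Banach space, and let $\mu\ge 1$ be a constant such that $\frac1\mu\|x-y\|^2\le\phi(x,y)$ for all $x,y\in X$. Let $\alpha,\beta\in\mathbb{R}$ with $\alpha+\beta>0$. Let $A:X\to 2^{X^*}$ be maximally monotone and $\alpha$-monotone, and let $B:X\to X^*$ be $\beta$-monotone and Lipschitz with constant $L>0$. Let $\epsilon$ satisfy $0<\epsilon<\alpha+\beta$ and let $(\lambda_n)_{n\ge -1}\subseteq\left[\epsilon,\frac{1-2\epsilon}{2\mu L}\right]$. For $x_0,x_{-1}\in X$ define $$x_{n+1}=J^A_{\lambda_n}\circ J^{-1}\bigl(Jx_n-\lambda_nBx_n-\lambda_{n-1}(Bx_n-Bx_{n-1})\bigr),\qquad n\ge 0.$$ Suppose $(A+B)^{-1}(0)\neq\emptyset$. Then $(x_n)$ converges strongly to an element $x^*$ of $(A+B)^{-1}(0)$ with $R$-linear rate.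
   Context: $J:X\to X^*$ is the normalized duality mapping: $Jx$ is the functional with $\langle x,Jx\rangle=\|x\|^2=\|Jx\|^2$ (single-valued and bijective here). $\phi(x,y)=\|x\|^2-2\langle x,Jy\rangle+\|y\|^2$. $X$ is 2-uniformly convex if its modulus of convexity satisfies $\delta_X(\varepsilon)\ge C\varepsilon^2$ for some $C>0$ and all $\varepsilon>0$ (on such a smooth space a constant $\mu$ as in the claim exists). For $\alpha\in\mathbb{R}$, an operator $A:X\rightrightarrows X^*$ is $\alpha$-monotone if $\langle x-y,u-v\rangle\ge\alpha\langle x-y,Jx-Jy\rangle$ for all $(x,u),(y,v)\in\mathrm{gra}\,A$; monotone means $0$-monotone, and maximally monotone means monotone with no proper monotone extension of the graph. $J^A_\lambda:=(J+\lambda A)^{-1}J$, so $J^A_\lambda\circ J^{-1}=(J+\lambda A)^{-1}$. $(A+B)^{-1}(0)=\{x: 0\in Ax+Bx\}$. Convergence with $R$-linear rate means that there are $M\ge 0$ and $q\in(0,1)$ with $\|x_n-x^*\|\le Mq^n$ for all $n\geq 0$. *)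

theory Defs
  imports "HOL-Analysis.Analysis"
begin

type_synonym 'a dual = "'a \<Rightarrow>\<^sub>L real"

text \<open>
  Both moduli take values in $[0,\infty]$: the quantities involved are nonnegative by the triangle
  inequality, so \<^const>\<open>ennreal\<close> does not truncate anything, and the infimum (supremum) over the
  empty set is $\infty$ (respectively $0$). Thus \<open>\<epsilon> > 2\<close> and the zero space need no special
  treatment.
\<close>

definition modulus_of_convexity :: "'a::real_normed_vector itself \<Rightarrow> real \<Rightarrow> ennreal" where
  "modulus_of_convexity _ \<epsilon> =
     Inf {ennreal (1 - norm ((1/2) *\<^sub>R (x + y))) | x y :: 'a.
            norm x = 1 \<and> norm y = 1 \<and> norm (x - y) \<ge> \<epsilon>}"

definition two_uniformly_convex :: "'a::real_normed_vector itself \<Rightarrow> bool" where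
  "two_uniformly_convex X \<longleftrightarrow>
     (\<exists>C>0. \<forall>\<epsilon>>0. modulus_of_convexity X \<epsilon> \<ge> ennreal (C * \<epsilon>\<^sup>2))"

definition modulus_of_smoothness :: "'a::real_normed_vector itself \<Rightarrow> real \<Rightarrow> ennreal" where
  "modulus_of_smoothness _ t =
     Sup {ennreal ((norm (x + t *\<^sub>R y) + norm (x - t *\<^sub>R y)) / 2 - 1) | x y :: 'a.
            norm x = 1 \<and> norm y = 1}"

definition uniformly_smooth :: "'a::real_normed_vector itself \<Rightarrow> bool" where
  "uniformly_smooth X \<longleftrightarrow>
     ((\<lambda>t. modulus_of_smoothness X t / ennreal t) \<longlongrightarrow> 0) (at_right 0)"

text \<open>
  The pairing $\langle x, f\rangle$ is \<open>blinfun_apply f x\<close>. The functional below exists on every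
  normed space and is unique when the space is smooth, so the description is only
  meaningful there.
\<close>

definition duality_map :: "'a::real_normed_vector \<Rightarrow> 'a dual" where
  "duality_map x = (THE f. blinfun_apply f x = (norm x)\<^sup>2 \<and> (norm f)\<^sup>2 = (norm x)\<^sup>2)"

definition phi :: "'a::real_normed_vector \<Rightarrow> 'a \<Rightarrow> real" where
  "phi x y = (norm x)\<^sup>2 - 2 * blinfun_apply (duality_map y) x + (norm y)\<^sup>2"

definition graph_of :: "('a \<Rightarrow> 'b set) \<Rightarrow> ('a \<times> 'b) set" where
  "graph_of T = {(x, u). u \<in> T x}"

definition op_inverse :: "('a \<Rightarrow> 'b set) \<Rightarrow> 'b \<Rightarrow> 'a set" where
  "op_inverse T u = {x. u \<in> T x}"

definition op_plus :: "('a \<Rightarrow> 'b::plus set) \<Rightarrow> ('a \<Rightarrow> 'b set) \<Rightarrow> 'a \<Rightarrow> 'b set" where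
  "op_plus S T x = {u + v | u v. u \<in> S x \<and> v \<in> T x}"

definition op_scale :: "real \<Rightarrow> ('a \<Rightarrow> 'b::real_vector set) \<Rightarrow> 'a \<Rightarrow> 'b set" where
  "op_scale c T x = (\<lambda>u. c *\<^sub>R u) ` T x"

definition op_of_fun :: "('a \<Rightarrow> 'b) \<Rightarrow> 'a \<Rightarrow> 'b set" where
  "op_of_fun f x = {f x}"

definition alpha_monotone :: "real \<Rightarrow> ('a::real_normed_vector \<Rightarrow> 'a dual set) \<Rightarrow> bool" where
  "alpha_monotone \<alpha> T \<longleftrightarrow>
     (\<forall>(x, u) \<in> graph_of T. \<forall>(y, v) \<in> graph_of T.
        blinfun_apply (u - v) (x - y)
          \<ge> \<alpha> * blinfun_apply (duality_map x - duality_map y) (x - y))"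

definition maximally_monotone :: "('a::real_normed_vector \<Rightarrow> 'a dual set) \<Rightarrow> bool" where
  "maximally_monotone T \<longleftrightarrow>
     alpha_monotone 0 T \<and>
     (\<forall>S. alpha_monotone 0 S \<and> graph_of T \<subseteq> graph_of S \<longrightarrow> graph_of S = graph_of T)"

text \<open>
  The set-valued inverse in the resolvent $(J+\lambda A)^{-1}J$ is a singleton for maximally monotone \<open>A\<close>
  and \<open>\<lambda> > 0\<close> on the spaces considered, whence \<^const>\<open>the_elem\<close>.
\<close>

definition resolvent ::
  "('a::real_normed_vector \<Rightarrow> 'a dual set) \<Rightarrow> real \<Rightarrow> 'a \<Rightarrow> 'a" where
  "resolvent A l x =
     the_elem (op_inverse (op_plus (op_of_fun duality_map) (op_scale l A)) (duality_map x))"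

definition R_linear_convergence :: "(nat \<Rightarrow> 'a::real_normed_vector) \<Rightarrow> 'a \<Rightarrow> bool" where
  "R_linear_convergence x l \<longleftrightarrow>
     (\<exists>M\<ge>0. \<exists>q\<in>{0<..<1}. \<forall>n. norm (x n - l) \<le> M * q ^ n)"

end

theory Submission
  imports Defs
begin

text \<open>
  For \<open>g x = (norm x)\<^sup>2 / 2\<close>, uniform smoothness makes the directional derivative of \<open>g\<close> at \<open>x\<close> linear;
  it is the duality map \<open>J x\<close>. The bound on \<^const>\<open>phi\<close> says that \<open>g\<close> is strongly convex, so
  \<open>g - f\<close> has a minimiser for every functional \<open>f\<close> and \<open>J\<close> is bijective with Lipschitz inverse. That \<open>J + \<lambda>A\<close>
  is onto with single-valued inverse reduces to finding \<open>x\<close> with \<open>(x, - J x)\<close> in a given maximally monotone graph;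
  such an \<open>x\<close> comes from a minimiser of the Fitzpatrick function plus
  \<open>(x, J u) \<mapsto> g x + g u\<close>, which exists by strong convexity and the demicontinuity of \<open>J\<close>.
  Along the iteration, with \<open>k = (1 - 2 \<epsilon>) / (2 \<mu>)\<close> and a zero \<open>z\<close> of \<open>A + B\<close>, the quantity
  \<open>V n = phi z (x n) - 2 \<lambda>\<^bsub>n-1\<^esub> \<langle>x n - z, B (x n) - B (x (n-1))\<rangle> + k (norm (x n - x (n-1)))\<^sup>2\<close>
  contracts by a fixed factor and dominates \<open>phi z (x n) / 2\<close>.
\<close>

section \<open>From the modulus of smoothness to the squared norm\<close>

lemma uniformly_smooth_unit:
  assumes "uniformly_smooth TYPE('a::real_normed_vector)" and "0 < e"
  shows "\<forall>\<^sub>F t in at_right 0. \<forall>x y :: 'a. norm x = 1 \<longrightarrow> norm y = 1 \<longrightarrow>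
           norm (x + t *\<^sub>R y) + norm (x - t *\<^sub>R y) \<le> 2 + e * t"
proof -
  have "\<forall>\<^sub>F t in at_right 0. modulus_of_smoothness TYPE('a) t / ennreal t < ennreal (e / 2)"
    using assms by (auto simp: uniformly_smooth_def intro!: order_tendstoD(2))
  moreover have "\<forall>\<^sub>F t in at_right 0. (0::real) < t"
    by (rule eventually_at_right_less)
  ultimately show ?thesis
  proof eventually_elim
    case (elim t)
    show ?case
    proof (intro allI impI)
      fix x y :: 'a
      assume xy: "norm x = 1" "norm y = 1"
      let ?s = "(norm (x + t *\<^sub>R y) + norm (x - t *\<^sub>R y)) / 2 - 1"
      have "ennreal ?s \<le> modulus_of_smoothness TYPE('a) t"
        unfolding modulus_of_smoothness_def using xy by (auto intro!: Sup_upper)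
      then have "ennreal ?s / ennreal t \<le> ennreal (e / 2)"
        by (rule order_trans[OF divide_right_mono_ennreal less_imp_le[OF elim(1)]])
      then have "ennreal (?s / t) \<le> ennreal (e / 2)"
      proof (cases "0 \<le> ?s")
        case False
        then have "?s / t \<le> 0" using elim(2) by (simp add: divide_le_0_iff)
        then have "?s / t \<le> e / 2" using assms(2) by linarith
        then show ?thesis by (rule ennreal_leI)
      qed (use elim(2) in \<open>simp add: divide_ennreal\<close>)
      then have "?s / t \<le> e / 2"
        using assms(2) by (subst (asm) ennreal_le_iff) auto
      then show "norm (x + t *\<^sub>R y) + norm (x - t *\<^sub>R y) \<le> 2 + e * t"
        using elim(2) by (simp add: field_simps)
    qed
  qed
qed

lemma power2_diff_le:
  fixes a r d :: real
  assumes "\<bar>a - r\<bar> \<le> d"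
  shows "a\<^sup>2 - r\<^sup>2 \<le> 2 * r * (a - r) + d\<^sup>2"
proof -
  have "(a - r)\<^sup>2 \<le> d\<^sup>2"
    using assms by (metis abs_ge_zero power2_abs power_mono)
  then show ?thesis
    by (simp add: power2_eq_square algebra_simps)
qed

lemma power2_norm_convex:
  fixes x y :: "'a::real_normed_vector"
  assumes "0 \<le> s" "0 \<le> t" "s + t = 1"
  shows "(norm (s *\<^sub>R x + t *\<^sub>R y))\<^sup>2 \<le> s * (norm x)\<^sup>2 + t * (norm y)\<^sup>2"
proof -
  have "norm (s *\<^sub>R x + t *\<^sub>R y) \<le> s * norm x + t * norm y"
    using assms norm_triangle_ineq[of "s *\<^sub>R x" "t *\<^sub>R y"] by simp
  then have "(norm (s *\<^sub>R x + t *\<^sub>R y))\<^sup>2 \<le> (s * norm x + t * norm y)\<^sup>2"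
    by (intro power_mono) auto
  also have "\<dots> = s * (norm x)\<^sup>2 + t * (norm y)\<^sup>2 - s * t * (norm x - norm y)\<^sup>2"
  proof -
    have s: "s = 1 - t" using assms(3) by simp
    show ?thesis unfolding s by (simp add: power2_eq_square algebra_simps)
  qed
  also have "\<dots> \<le> s * (norm x)\<^sup>2 + t * (norm y)\<^sup>2"
    using assms by simp
  finally show ?thesis .
qed

text \<open>With \<open>a\<close>, \<open>b\<close> the norms of \<open>x + t y\<close>,
  \<open>x - t y\<close> and \<open>r = norm x\<close>, both squares are expanded about
  \<open>r\<close>. The linear part \<open>2 r (a + b - 2 r)\<close> is small compared with
  \<open>t\<close> by smoothness, after normalising \<open>x\<close> and \<open>y\<close>; the
  quadratic remainder is of order \<open>t^2\<close>.\<close>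

lemma uniformly_smooth_power2_norm:
  fixes x y :: "'a::real_normed_vector"
  assumes "uniformly_smooth TYPE('a)"
  shows "((\<lambda>t. ((norm (x + t *\<^sub>R y))\<^sup>2 + (norm (x - t *\<^sub>R y))\<^sup>2 - 2 * (norm x)\<^sup>2) / t) \<longlongrightarrow> 0)
           (at_right 0)" (is "(?f \<longlongrightarrow> 0) _")
proof (cases "x = 0 \<or> y = 0")
  case True
  have "((\<lambda>t. 2 * t * (norm y)\<^sup>2) \<longlongrightarrow> 2 * 0 * (norm y)\<^sup>2) (at_right (0::real))"
    by (intro tendsto_intros)
  moreover have "\<forall>\<^sub>F t in at_right (0::real). ?f t = 2 * t * (norm y)\<^sup>2"
    using eventually_at_right_less
    by eventually_elim (use True in \<open>auto simp: power2_eq_square\<close>)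
  ultimately show ?thesis
    by (simp add: tendsto_cong)
next
  case False
  then have pos: "norm x > 0" "norm y > 0" by auto
  define c where "c = norm y / norm x"
  have c: "c > 0" using pos by (simp add: c_def)
  show ?thesis
  proof (rule order_tendstoI)
    fix e :: real
    assume "e < 0"
    show "\<forall>\<^sub>F t in at_right 0. e < ?f t"
      using eventually_at_right_less
    proof eventually_elim
      case (elim t)
      have "2 * (norm x)\<^sup>2 \<le> (norm (x + t *\<^sub>R y))\<^sup>2 + (norm (x - t *\<^sub>R y))\<^sup>2"
        using power2_norm_convex[of "1/2" "1/2" "x + t *\<^sub>R y" "x - t *\<^sub>R y"]
        by (simp add: scaleR_add_right[symmetric] scaleR_2[symmetric])
      then have "0 \<le> ?f t" using elim by simp
      then show ?case using \<open>e < 0\<close> by simp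
    qed
  next
    fix e :: real
    assume e: "0 < e"
    \<comment> \<open>Chosen so that the linear part, which carries the factor
      \<open>2 * norm x * norm y\<close>, is at most \<open>e / 2 * t\<close>; the other half of
      \<open>e\<close> is kept for the squares.\<close>
    define e' where "e' = e / (4 * norm x * norm y)"
    have e': "e' > 0" using e pos by (simp add: e'_def)
    have "filterlim (\<lambda>t. c * t) (at_right 0) (at_right 0)"
      unfolding filterlim_at
    proof
      show "((\<lambda>t. c * t) \<longlongrightarrow> 0) (at_right 0)"
        by (intro tendsto_eq_intros) auto
      show "\<forall>\<^sub>F t in at_right 0. c * t \<in> {0<..} \<and> c * t \<noteq> 0"
        using eventually_at_right_less by eventually_elim (use c in auto)
    qed
    from eventually_compose_filterlim[OF uniformly_smooth_unit[OF assms e'] this]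
    have "\<forall>\<^sub>F t in at_right 0. \<forall>u v :: 'a. norm u = 1 \<longrightarrow> norm v = 1 \<longrightarrow>
        norm (u + (c * t) *\<^sub>R v) + norm (u - (c * t) *\<^sub>R v) \<le> 2 + e' * (c * t)" .
    moreover have "\<forall>\<^sub>F t in at_right 0. 2 * t * (norm y)\<^sup>2 < e / 2"
    proof (rule order_tendstoD)
      show "((\<lambda>t. 2 * t * (norm y)\<^sup>2) \<longlongrightarrow> 2 * 0 * (norm y)\<^sup>2) (at_right (0::real))"
        by (intro tendsto_intros)
    qed (use e in simp)
    moreover have "\<forall>\<^sub>F t in at_right 0. (0::real) < t"
      by (rule eventually_at_right_less)
    ultimately show "\<forall>\<^sub>F t in at_right 0. ?f t < e"
    proof eventually_elim
      case (elim t)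
      define u v where "u = x /\<^sub>R norm x" and "v = y /\<^sub>R norm y"
      let ?a = "norm (x + t *\<^sub>R y)" and ?b = "norm (x - t *\<^sub>R y)" and ?r = "norm x"
      have "x + t *\<^sub>R y = norm x *\<^sub>R (u + (c * t) *\<^sub>R v)" "x - t *\<^sub>R y = norm x *\<^sub>R (u - (c * t) *\<^sub>R v)"
        using pos by (auto simp: u_def v_def c_def algebra_simps)
      then have ab: "?a = ?r * norm (u + (c * t) *\<^sub>R v)" "?b = ?r * norm (u - (c * t) *\<^sub>R v)"
        by auto
      have "norm (u + (c * t) *\<^sub>R v) + norm (u - (c * t) *\<^sub>R v) \<le> 2 + e' * (c * t)"
        using pos by (intro elim(1)[rule_format]) (auto simp: u_def v_def)
      then have "?r * (norm (u + (c * t) *\<^sub>R v) + norm (u - (c * t) *\<^sub>R v)) \<le> ?r * (2 + e' * (c * t))"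
        by (rule mult_left_mono) simp
      then have "?a + ?b \<le> ?r * (2 + e' * (c * t))"
        by (simp add: ab distrib_left)
      then have "?a + ?b - 2 * ?r \<le> e' * norm y * t"
        using pos by (simp add: c_def field_simps)
      then have "2 * ?r * (?a + ?b - 2 * ?r) \<le> 2 * ?r * (e' * norm y * t)"
        by (rule mult_left_mono) simp
      also have "\<dots> = e / 2 * t"
        using pos by (simp add: e'_def)
      finally have main: "2 * ?r * (?a - ?r) + 2 * ?r * (?b - ?r) \<le> e / 2 * t"
        by (simp add: algebra_simps)
      have "\<bar>?a - ?r\<bar> \<le> t * norm y" "\<bar>?b - ?r\<bar> \<le> t * norm y"
        using norm_triangle_ineq3[of "x + t *\<^sub>R y" x] norm_triangle_ineq3[of "x - t *\<^sub>R y" x] elim(3)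
        by auto
      then have "?a\<^sup>2 + ?b\<^sup>2 - 2 * ?r\<^sup>2 \<le> e / 2 * t + 2 * (t * norm y)\<^sup>2"
        using power2_diff_le[of ?a ?r] power2_diff_le[of ?b ?r] main by fastforce
      also have "2 * (t * norm y)\<^sup>2 = (2 * t * (norm y)\<^sup>2) * t"
        by (simp add: power2_eq_square)
      also have "\<dots> < e / 2 * t"
        using elim by (intro mult_strict_right_mono) auto
      finally show ?case
        using elim(3) by (simp add: field_simps)
    qed
  qed
qed

section \<open>One-sided derivatives of half the squared norm and the duality map\<close>

locale gateaux_smooth =
  fixes X :: "'a::real_normed_vector itself"
  assumes smooth: "\<And>x y :: 'a. ((\<lambda>t. ((norm (x + t *\<^sub>R y))\<^sup>2 + (norm (x - t *\<^sub>R y))\<^sup>2 - 2 * (norm x)\<^sup>2) / t)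
      \<longlongrightarrow> 0) (at_right 0)"
begin

definition quot :: "'a \<Rightarrow> 'a \<Rightarrow> real \<Rightarrow> real" where
  "quot x y t = ((norm (x + t *\<^sub>R y))\<^sup>2 - (norm x)\<^sup>2) / (2 * t)"

text \<open>\<open>quot x y\<close> is the difference quotient of half the squared norm,
  nondecreasing in \<open>t\<close> by convexity. Its infimum is thus the one-sided derivative at
  \<open>x\<close> along \<open>y\<close>, available before any limit is shown to exist.\<close>

definition slope :: "'a \<Rightarrow> 'a \<Rightarrow> real" where
  "slope x y = (INF t\<in>{0<..}. quot x y t)"

lemma quot_ge: "- (norm x * norm y) \<le> quot x y t" if "0 < t"
proof -
  let ?a = "norm (x + t *\<^sub>R y)"
  have "norm x - t * norm y \<le> ?a"
    using norm_triangle_ineq2[of x "- t *\<^sub>R y"] that by simp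
  have "(norm x)\<^sup>2 - 2 * t * (norm x * norm y) \<le> ?a\<^sup>2"
  proof (cases "norm x \<le> ?a")
    case True
    then have "(norm x)\<^sup>2 \<le> ?a\<^sup>2" by (intro power_mono) auto
    then show ?thesis using that by (smt (verit) mult_nonneg_nonneg norm_ge_zero)
  next
    case False
    have "(norm x - ?a) * (norm x + ?a) \<le> (t * norm y) * (2 * norm x)"
      using False \<open>norm x - t * norm y \<le> ?a\<close> that by (intro mult_mono) auto
    then show ?thesis by (simp add: power2_eq_square algebra_simps)
  qed
  then show ?thesis using that by (simp add: quot_def field_simps)
qed

lemma quot_le: "quot x y t \<le> norm x * norm y + t * ((norm y)\<^sup>2 / 2)" if "0 < t"
proof -
  have "norm (x + t *\<^sub>R y) \<le> norm x + t * norm y"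
    using norm_triangle_ineq[of x "t *\<^sub>R y"] that by simp
  then have "(norm (x + t *\<^sub>R y))\<^sup>2 \<le> (norm x + t * norm y)\<^sup>2"
    by (intro power_mono) auto
  then show ?thesis
    using that by (simp add: quot_def field_simps power2_eq_square)
qed

lemma slope_le_quot: "slope x y \<le> quot x y t" if "0 < t"
  unfolding slope_def using that quot_ge by (intro cINF_lower bdd_belowI2) auto

lemma slope_greatest: "c \<le> slope x y" if "\<And>t. 0 < t \<Longrightarrow> c \<le> quot x y t"
  unfolding slope_def using that by (intro cINF_greatest) auto

lemma slope_le_tendsto: "slope x y \<le> a"
  if "\<And>t. 0 < t \<Longrightarrow> quot x y t \<le> f t" and "(f \<longlongrightarrow> a) (at_right 0)"
proof (rule tendsto_lowerbound[OF that(2)])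
  show "\<forall>\<^sub>F t in at_right 0. slope x y \<le> f t"
    using eventually_at_right_less
    by eventually_elim (use slope_le_quot that(1) order_trans in blast)
qed simp

lemma slope_le: "slope x y \<le> norm x * norm y"
proof (rule slope_le_tendsto[OF quot_le])
  show "((\<lambda>t. norm x * norm y + t * ((norm y)\<^sup>2 / 2)) \<longlongrightarrow> norm x * norm y) (at_right 0)"
    by (rule tendsto_eq_intros refl | simp)+
qed

lemma slope_self: "slope x x = (norm x)\<^sup>2"
proof (rule antisym)
  show "slope x x \<le> (norm x)\<^sup>2"
    using slope_le[of x x] by (simp add: power2_eq_square)
  show "(norm x)\<^sup>2 \<le> slope x x"
  proof (rule slope_greatest)
    fix t :: real assume t: "0 < t"
    have "x + t *\<^sub>R x = (1 + t) *\<^sub>R x" by (simp add: algebra_simps)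
    then have "norm (x + t *\<^sub>R x) = (1 + t) * norm x" using t by simp
    then have "(norm (x + t *\<^sub>R x))\<^sup>2 = (norm x)\<^sup>2 + 2 * t * (norm x)\<^sup>2 + (t * norm x)\<^sup>2"
      by (simp add: power2_eq_square algebra_simps)
    then show "(norm x)\<^sup>2 \<le> quot x x t"
      using t by (simp add: quot_def field_simps)
  qed
qed

text \<open>Convexity of the squared norm compares one step along \<open>y + z\<close> with
  independent steps \<open>s\<close> along \<open>y\<close> and \<open>t\<close> along
  \<open>z\<close>; the two infima are then taken one after the other.\<close>

lemma slope_add_le: "slope x (y + z) \<le> slope x y + slope x z"
proof -
  have *: "slope x (y + z) \<le> quot x y s + quot x z t" if "0 < s" "0 < t" for s t
  proof -
    \<comment> \<open>The harmonic step makes \<open>x + r (y + z)\<close> a convex combination of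
      \<open>x + s y\<close> and \<open>x + t z\<close>.\<close>
    define r where "r = s * t / (s + t)"
    have r: "0 < r" using that by (simp add: r_def)
    have eq: "x + r *\<^sub>R (y + z) = (t / (s + t)) *\<^sub>R (x + s *\<^sub>R y) + (s / (s + t)) *\<^sub>R (x + t *\<^sub>R z)"
    proof -
      have "(t / (s + t)) *\<^sub>R x + (s / (s + t)) *\<^sub>R x = x"
        using that by (simp flip: scaleR_add_left add_divide_distrib add: add.commute)
      then show ?thesis
        by (simp add: r_def algebra_simps)
    qed
    have "(norm (x + r *\<^sub>R (y + z)))\<^sup>2
        \<le> t / (s + t) * (norm (x + s *\<^sub>R y))\<^sup>2 + s / (s + t) * (norm (x + t *\<^sub>R z))\<^sup>2"
      unfolding eq using that
      by (intro power2_norm_convex) (auto simp: add_divide_distrib[symmetric])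
    also have "\<dots> - (norm x)\<^sup>2 = 2 * r * (quot x y s + quot x z t)"
      using that by (simp add: quot_def r_def divide_simps) (simp add: algebra_simps)
    finally have "quot x (y + z) r \<le> quot x y s + quot x z t"
      using r unfolding quot_def[of x "y + z"] by (simp add: field_simps)
    then show ?thesis
      using slope_le_quot[OF r] by (rule order_trans[rotated])
  qed
  have "slope x (y + z) - slope x z \<le> slope x y"
  proof (rule slope_greatest)
    fix s :: real assume s: "0 < s"
    have "slope x (y + z) - quot x y s \<le> slope x z"
      using *[OF s] by (intro slope_greatest) (simp add: algebra_simps)
    then show "slope x (y + z) - slope x z \<le> quot x y s" by simp
  qed
  then show ?thesis by simp
qed

lemma quot_minus: "quot x y t + quot x (- y) t
    = ((norm (x + t *\<^sub>R y))\<^sup>2 + (norm (x - t *\<^sub>R y))\<^sup>2 - 2 * (norm x)\<^sup>2) / t / 2"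
  by (simp add: quot_def add_divide_distrib[symmetric] mult.commute)

text \<open>One inequality is subadditivity at \<open>y + (- y) = 0\<close>. The other is where
  smoothness enters: the two quotients add up to half the symmetric second difference over
  \<open>t\<close>, which tends to 0.\<close>

lemma slope_minus: "slope x (- y) = - slope x y"
proof (rule antisym)
  have "slope x y + slope x (- y) \<le> 0"
  proof (rule tendsto_lowerbound)
    show "((\<lambda>t. quot x y t + quot x (- y) t) \<longlongrightarrow> 0) (at_right 0)"
      unfolding quot_minus using tendsto_divide[OF smooth tendsto_const[of 2]] by simp
    show "\<forall>\<^sub>F t in at_right 0. slope x y + slope x (- y) \<le> quot x y t + quot x (- y) t"
      using eventually_at_right_less by eventually_elim (intro add_mono slope_le_quot)
  qed simp
  then show "slope x (- y) \<le> - slope x y" by simp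
  have "0 \<le> slope x 0" by (rule slope_greatest) (simp add: quot_def)
  then show "- slope x y \<le> slope x (- y)"
    using slope_add_le[of x y "- y"] by simp
qed

lemma slope_add: "slope x (y + z) = slope x y + slope x z"
  using slope_add_le[of x y z] slope_add_le[of x "y + z" "- z"] slope_minus[of x z] by simp

lemma slope_zero: "slope x 0 = 0"
  using slope_minus[of x 0] by simp

lemma slope_scaleR_pos_le: "slope x (c *\<^sub>R y) \<le> c * slope x y" if "0 < c"
proof -
  have "slope x (c *\<^sub>R y) / c \<le> slope x y"
  proof (rule slope_greatest)
    fix s :: real assume s: "0 < s"
    have "slope x (c *\<^sub>R y) \<le> quot x (c *\<^sub>R y) (s / c)"
      using s that by (intro slope_le_quot) simp
    also have "\<dots> = c * quot x y s"
      using that by (simp add: quot_def)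
    finally show "slope x (c *\<^sub>R y) / c \<le> quot x y s"
      using that by (simp add: field_simps)
  qed
  then show ?thesis using that by (simp add: field_simps)
qed

lemma slope_scaleR_pos: "slope x (c *\<^sub>R y) = c * slope x y" if "0 < c"
  using slope_scaleR_pos_le[OF that, of x y] slope_scaleR_pos_le[OF that, of x "- y"]
  by (simp add: slope_minus)

lemma slope_scaleR: "slope x (c *\<^sub>R y) = c * slope x y"
proof (cases c "0 :: real" rule: linorder_cases)
  case less
  then have "slope x ((- c) *\<^sub>R y) = - c * slope x y"
    by (intro slope_scaleR_pos) simp
  then show ?thesis by (simp add: slope_minus)
qed (simp_all add: slope_zero slope_scaleR_pos)

lemma abs_slope_le: "\<bar>slope x y\<bar> \<le> norm x * norm y"
  using slope_le[of x y] slope_le[of x "- y"] by (simp add: slope_minus)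

lemma bounded_linear_slope: "bounded_linear (slope x)"
  by (rule bounded_linear_intro[where K = "norm x"])
    (use abs_slope_le in \<open>auto simp: slope_add slope_scaleR mult.commute[of _ "norm x"]\<close>)

text \<open>A norming functional is a subgradient of half the squared norm, hence lies below
  \<open>slope x\<close>; the bound at \<open>- y\<close> gives the reverse, since both sides are
  odd.\<close>

lemma norm_functional_unique:
  assumes f: "blinfun_apply f x = (norm x)\<^sup>2" "(norm f)\<^sup>2 = (norm x)\<^sup>2"
  shows "blinfun_apply f y = slope x y"
proof -
  have nf: "norm f = norm x" using f(2) by simp
  have le: "blinfun_apply f y \<le> slope x y" for y
  proof (rule slope_greatest)
    fix t :: real assume t: "0 < t"
    have "(norm x)\<^sup>2 + t * blinfun_apply f y = blinfun_apply f (x + t *\<^sub>R y)"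
      using f by (simp add: blinfun.add_right blinfun.scaleR_right)
    also have "\<dots> \<le> norm x * norm (x + t *\<^sub>R y)"
      using norm_blinfun[of f "x + t *\<^sub>R y"] nf by simp
    also have "\<dots> \<le> ((norm x)\<^sup>2 + (norm (x + t *\<^sub>R y))\<^sup>2) / 2"
      using sum_squares_bound[of "norm x" "norm (x + t *\<^sub>R y)"] by simp
    finally show "blinfun_apply f y \<le> quot x y t"
      using t by (simp add: quot_def field_simps)
  qed
  from le[of y] le[of "- y"] show ?thesis
    by (simp add: slope_minus blinfun.minus_right)
qed

text \<open>Justifies the description in \<open>duality_map\<close>: the bounded linear functional
  \<open>slope x\<close> is norming, and every norming functional equals it.\<close>

lemma duality_map_ex1: "\<exists>!f. blinfun_apply f x = (norm x)\<^sup>2 \<and> (norm f)\<^sup>2 = (norm x)\<^sup>2" for x :: 'a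
proof
  let ?f = "Blinfun (slope x)"
  have f: "blinfun_apply ?f y = slope x y" for y
    by (simp add: bounded_linear_Blinfun_apply bounded_linear_slope)
  have "norm ?f \<le> norm x"
    using abs_slope_le by (intro norm_blinfun_bound) (auto simp: f)
  moreover have "norm x \<le> norm ?f"
  proof (cases "x = 0")
    case False
    have "norm x * norm x \<le> norm ?f * norm x"
      using norm_blinfun[of ?f x] by (simp add: f slope_self power2_eq_square)
    then show ?thesis using False by simp
  qed simp
  ultimately show "blinfun_apply ?f x = (norm x)\<^sup>2 \<and> (norm ?f)\<^sup>2 = (norm x)\<^sup>2"
    by (simp add: f slope_self)
  show "g = ?f" if "blinfun_apply g x = (norm x)\<^sup>2 \<and> (norm g)\<^sup>2 = (norm x)\<^sup>2" for g
    by (rule blinfun_eqI) (use that norm_functional_unique in \<open>simp add: f\<close>)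
qed

lemma duality_map_props:
  "blinfun_apply (duality_map x) x = (norm x)\<^sup>2" "(norm (duality_map x))\<^sup>2 = (norm x)\<^sup>2"
  for x :: 'a
  using theI'[OF duality_map_ex1[of x]] unfolding duality_map_def by auto

lemma norm_duality_map: "norm (duality_map x) = norm x" for x :: 'a
  using duality_map_props(2)[of x] by simp

lemma duality_map_eq_slope: "blinfun_apply (duality_map x) y = slope x y"
  using norm_functional_unique[OF duality_map_props] .

lemma duality_map_unique:
  fixes x :: 'a
  assumes "blinfun_apply f x = (norm x)\<^sup>2" "norm f = norm x"
  shows "duality_map x = f"
  using assms duality_map_ex1[of x] duality_map_props[of x] by metis

lemma duality_map_le_quot: "blinfun_apply (duality_map x) y \<le> quot x y t" if "0 < t"
  using slope_le_quot[OF that] by (simp add: duality_map_eq_slope)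

lemma duality_map_pairing_le: "\<bar>blinfun_apply (duality_map x) y\<bar> \<le> norm x * norm y" for x y :: 'a
  using abs_slope_le by (simp add: duality_map_eq_slope)

lemma duality_map_minus: "duality_map (- x) = - duality_map x" for x :: 'a
  by (rule duality_map_unique) (simp_all add: blinfun.bilinear_simps duality_map_props norm_duality_map)

text \<open>The quotient along \<open>- y\<close> is at least minus the pairing, so the quotient
  along \<open>y\<close> exceeds the pairing by at most the sum of both quotients, which tends to
  0.\<close>

lemma quot_tendsto: "((\<lambda>t. quot x y t) \<longlongrightarrow> blinfun_apply (duality_map x) y) (at_right 0)"
proof (rule tendsto_sandwich)
  let ?J = "blinfun_apply (duality_map x) y"
  show "\<forall>\<^sub>F t in at_right 0. ?J \<le> quot x y t"
    using eventually_at_right_less by eventually_elim (rule duality_map_le_quot)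
  show "\<forall>\<^sub>F t in at_right 0. quot x y t \<le> (quot x y t + quot x (- y) t) + ?J"
    using eventually_at_right_less
  proof eventually_elim
    case (elim t)
    from duality_map_le_quot[OF this, of x "- y"] show ?case
      by (simp add: blinfun.minus_right)
  qed
  show "((\<lambda>t. (quot x y t + quot x (- y) t) + ?J) \<longlongrightarrow> ?J) (at_right 0)"
    unfolding quot_minus
    using tendsto_add[OF tendsto_divide[OF smooth tendsto_const[of 2]] tendsto_const[of ?J]] by simp
qed simp

text \<open>The pairing is an infimum over \<open>t\<close> of the functions
  \<open>quot x y t\<close>, continuous in \<open>x\<close>, hence upper semicontinuous; replacing
  \<open>y\<close> by \<open>- y\<close> gives lower semicontinuity.\<close>

lemma duality_map_demicontinuous:
  fixes u :: "'b \<Rightarrow> 'a"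
  assumes "(u \<longlongrightarrow> l) F"
  shows "((\<lambda>n. blinfun_apply (duality_map (u n)) y) \<longlongrightarrow> blinfun_apply (duality_map l) y) F"
proof -
  have upper: "\<forall>\<^sub>F n in F. blinfun_apply (duality_map (u n)) y < a"
    if a: "blinfun_apply (duality_map l) y < a" for a y
  proof -
    have "\<forall>\<^sub>F t in at_right 0. quot l y t < a \<and> 0 < t"
      using order_tendstoD(2)[OF quot_tendsto a] eventually_at_right_less
      by eventually_elim simp
    then obtain t where t: "quot l y t < a" "0 < t"
      using eventually_happens' trivial_limit_at_right_real by blast
    have "((\<lambda>n. quot (u n) y t) \<longlongrightarrow> quot l y t) F"
      unfolding quot_def using t(2) by (intro tendsto_intros assms) auto
    then have "\<forall>\<^sub>F n in F. quot (u n) y t < a"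
      using t(1) by (rule order_tendstoD(2))
    then show ?thesis
      by eventually_elim (use duality_map_le_quot[OF t(2)] le_less_trans in blast)
  qed
  show ?thesis
  proof (rule order_tendstoI)
    fix a assume "a < blinfun_apply (duality_map l) y"
    then show "\<forall>\<^sub>F n in F. a < blinfun_apply (duality_map (u n)) y"
      using upper[of "- y" "- a"] by (simp add: blinfun.minus_right)
  qed (rule upper)
qed

lemma phi_three_point:
  "phi z x - phi z y - phi y x = 2 * blinfun_apply (duality_map x - duality_map y) (y - z)"
  for x y z :: 'a
  by (simp add: phi_def blinfun.bilinear_simps duality_map_props algebra_simps)

lemma phi_symmetrized:
  "phi x y + phi y x = 2 * blinfun_apply (duality_map x - duality_map y) (x - y)" for x y :: 'a
  by (simp add: phi_def blinfun.bilinear_simps duality_map_props algebra_simps)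

end

section \<open>Existence of minimisers\<close>

text \<open>The \<open>S c\<close> are sublevel sets of a function that may be infinite and is
  therefore not named. \<open>gap\<close> is what strong convexity yields: for two points of a level
  some point lies lower by a multiple of their squared distance. So the sublevel sets shrink near
  the infimum and Cantor's intersection theorem applies.\<close>

lemma sublevel_minimum:
  fixes S :: "real \<Rightarrow> 'p::complete_space set"
  assumes mono: "\<And>c d. c \<le> d \<Longrightarrow> S c \<subseteq> S d"
    and nonempty: "S c0 \<noteq> {}"
    and bounded: "\<And>c. S c \<noteq> {} \<Longrightarrow> b \<le> c"
    and closed: "\<And>c. closed (S c)"
    and right_cont: "\<And>c p. (\<And>e. 0 < e \<Longrightarrow> p \<in> S (c + e)) \<Longrightarrow> p \<in> S c"
    and K: "0 < K"
    and gap: "\<And>c p q. p \<in> S c \<Longrightarrow> q \<in> S c \<Longrightarrow> S (c - K * (dist p q)\<^sup>2) \<noteq> {}"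
  obtains m p where "p \<in> S m" "\<And>c. c < m \<Longrightarrow> S c = {}"
proof -
  define m where "m = Inf {c. S c \<noteq> {}}"
  have bdd: "bdd_below {c. S c \<noteq> {}}"
    using bounded by (auto intro!: bdd_belowI)
  have m_le: "m \<le> c" if "S c \<noteq> {}" for c
    unfolding m_def using that bdd by (auto intro: cInf_lower)
  have S_ne: "S (m + e) \<noteq> {}" if "0 < e" for e
  proof -
    have "Inf {c. S c \<noteq> {}} < m + e" using that by (simp add: m_def)
    then obtain c where "S c \<noteq> {}" "c < m + e"
      using nonempty bdd by (subst (asm) cInf_less_iff) auto
    then show ?thesis using mono[of c "m + e"] by auto
  qed
  obtain p where p: "\<And>n. p \<in> S (m + inverse (Suc n))"
  proof (rule decreasing_closed_nest[of "\<lambda>n. S (m + inverse (Suc n))"])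
    show "closed (S (m + inverse (Suc n)))" for n by (rule closed)
    show "S (m + inverse (Suc n)) \<noteq> {}" for n by (rule S_ne) simp
    show "S (m + inverse (Suc n)) \<subseteq> S (m + inverse (Suc k))" if "k \<le> n" for k n
      using that by (intro mono) (simp add: le_imp_inverse_le)
    fix e :: real assume e: "0 < e"
    obtain n where n: "inverse (real (Suc n)) < K * e\<^sup>2"
      using reals_Archimedean[of "K * e\<^sup>2"] e K by auto
    have "dist p q < e" if "p \<in> S (m + inverse (Suc n))" "q \<in> S (m + inverse (Suc n))" for p q
    proof -
      \<comment> \<open>Levels below \<open>m\<close> are empty, so the drop given by
        \<open>gap\<close> is at most the height \<open>inverse (Suc n)\<close> above
        \<open>m\<close>.\<close>
      have "K * (dist p q)\<^sup>2 \<le> inverse (Suc n)"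
        using m_le[OF gap[OF that]] by simp
      then have "(dist p q)\<^sup>2 < e\<^sup>2"
        using n K by (smt (verit) mult_less_cancel_left_pos)
      then show ?thesis using e by (meson less_imp_le power2_less_imp_less)
    qed
    then show "\<exists>n. \<forall>p\<in>S (m + inverse (Suc n)). \<forall>q\<in>S (m + inverse (Suc n)). dist p q < e"
      by blast
  qed blast
  have "p \<in> S m"
  proof (rule right_cont)
    fix e :: real assume "0 < e"
    then obtain n where "inverse (real (Suc n)) < e" using reals_Archimedean by blast
    then show "p \<in> S (m + e)" using p[of n] mono[of "m + inverse (Suc n)" "m + e"] by auto
  qed
  moreover have "S c = {}" if "c < m" for c
    using m_le[of c] that by auto
  ultimately show thesis by (rule that)
qed

section \<open>Strong convexity and bijectivity of the duality map\<close>

locale gateaux_smooth_strongly_convex = gateaux_smooth X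
  for X :: "'a::banach itself" +
  fixes \<mu> :: real
  assumes mu_pos: "0 < \<mu>"
    and phi_ge: "\<And>y z :: 'a. (1 / \<mu>) * (norm (y - z))\<^sup>2 \<le> phi y z"
begin

abbreviation J :: "'a \<Rightarrow> 'a dual" where
  "J \<equiv> duality_map"

lemma phi_nonneg: "0 \<le> phi x y" for x y :: 'a
  using phi_ge[of x y] mu_pos by (smt (verit) divide_nonneg_pos mult_nonneg_nonneg zero_le_power2)

lemma duality_map_strongly_monotone:
  "(1 / \<mu>) * (norm (x - y))\<^sup>2 \<le> blinfun_apply (J x - J y) (x - y)"
  using phi_ge[of x y] phi_ge[of y x] phi_symmetrized[of x y] by (simp add: norm_minus_commute)

lemma duality_map_expanding: "norm (x - y) \<le> \<mu> * norm (J x - J y)"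
proof (cases "x = y")
  case False
  have "(1 / \<mu>) * (norm (x - y))\<^sup>2 \<le> norm (J x - J y) * norm (x - y)"
    using duality_map_strongly_monotone[of x y] norm_blinfun[of "J x - J y" "x - y"] by simp
  then have "norm (x - y) * norm (x - y) \<le> (\<mu> * norm (J x - J y)) * norm (x - y)"
    using mu_pos by (simp add: field_simps power2_eq_square)
  then show ?thesis using False by simp
qed (use mu_pos in simp)

lemma inj_duality_map: "inj J"
proof (rule injI)
  fix x y assume "J x = J y"
  then show "x = y" using duality_map_expanding[of x y] by simp
qed

text \<open>Sum of \<open>phi_ge\<close> at \<open>(x, m)\<close> and \<open>(y, m)\<close> for the
  midpoint \<open>m\<close>, where the pairings with \<open>J m\<close> add up to twice the squared
  norm of \<open>m\<close>.\<close>

lemma power2_norm_midpoint: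
  "(norm (x - y))\<^sup>2 / (2 * \<mu>) \<le> (norm x)\<^sup>2 + (norm y)\<^sup>2 - 2 * (norm ((1/2) *\<^sub>R (x + y)))\<^sup>2" for x y :: 'a
proof -
  define m where "m = (1/2) *\<^sub>R (x + y)"
  have xy: "x + y = 2 *\<^sub>R m" by (simp add: m_def)
  have "x - m = (1/2) *\<^sub>R (x - y)" "y - m = (1/2) *\<^sub>R (y - x)"
    by (simp_all add: m_def algebra_simps flip: scaleR_add_left)
  then have d: "(norm (x - m))\<^sup>2 = (norm (x - y))\<^sup>2 / 4" "(norm (y - m))\<^sup>2 = (norm (x - y))\<^sup>2 / 4"
    by (simp_all add: power_mult_distrib norm_minus_commute power2_eq_square)
  have "blinfun_apply (J m) x + blinfun_apply (J m) y = 2 * (norm m)\<^sup>2"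
    using duality_map_props(1)[of m] by (simp flip: blinfun.add_right add: xy blinfun.scaleR_right)
  then have "phi x m + phi y m = (norm x)\<^sup>2 + (norm y)\<^sup>2 - 2 * (norm m)\<^sup>2"
    by (simp add: phi_def)
  then show ?thesis
    using phi_ge[of x m] phi_ge[of y m] by (simp add: d flip: m_def)
qed

lemma surj_duality_map: "surj J"
  unfolding surj_def
proof
  fix f :: "'a dual"
  define h where "h x = (norm x)\<^sup>2 / 2 - blinfun_apply f x" for x
  \<comment> \<open>The lower bound is Young's inequality. \<open>1 / (8 * \<mu>)\<close> is a
    quarter of the constant in \<open>power2_norm_midpoint\<close>: \<open>h\<close> halves the
    squared norm and the midpoint averages two values.\<close>
  obtain m p where p: "p \<in> {x. h x \<le> m}" and m: "\<And>c. c < m \<Longrightarrow> {x. h x \<le> c} = {}"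
  proof (rule sublevel_minimum[of "\<lambda>c. {x. h x \<le> c}" "h 0" "- (norm f)\<^sup>2 / 2" "1 / (8 * \<mu>)"])
    show "- (norm f)\<^sup>2 / 2 \<le> c" if ne: "{x. h x \<le> c} \<noteq> {}" for c
    proof -
      from ne obtain x where x: "h x \<le> c" by blast
      have "blinfun_apply f x \<le> norm f * norm x"
        using norm_blinfun[of f x] by simp
      also have "\<dots> \<le> ((norm f)\<^sup>2 + (norm x)\<^sup>2) / 2"
        using sum_squares_bound[of "norm f" "norm x"] by simp
      finally show ?thesis using x by (simp add: h_def field_simps)
    qed
    show "closed {x. h x \<le> c}" for c
      unfolding h_def by (intro closed_Collect_le continuous_intros) auto
    show "p \<in> {x. h x \<le> c}" if "\<And>e. 0 < e \<Longrightarrow> p \<in> {x. h x \<le> c + e}" for c p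
      using that by (auto intro: field_le_epsilon)
    show "{x. h x \<le> c - 1 / (8 * \<mu>) * (dist p q)\<^sup>2} \<noteq> {}"
      if "p \<in> {x. h x \<le> c}" "q \<in> {x. h x \<le> c}" for c p q
    proof -
      have "h ((1/2) *\<^sub>R (p + q)) \<le> c - 1 / (8 * \<mu>) * (dist p q)\<^sup>2"
        using that power2_norm_midpoint[of p q]
        by (simp add: h_def blinfun.bilinear_simps dist_norm field_simps del: norm_scaleR)
      then show ?thesis by blast
    qed
  qed (use mu_pos in auto)
  have min: "h p \<le> h x" for x
    using p m[of "h x"] by fastforce
  have ge: "blinfun_apply f y \<le> blinfun_apply (J p) y" for y
  proof (rule tendsto_lowerbound[OF quot_tendsto])
    show "\<forall>\<^sub>F t in at_right 0. blinfun_apply f y \<le> quot p y t"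
      using eventually_at_right_less
    proof eventually_elim
      case (elim t)
      then show ?case
        using min[of "p + t *\<^sub>R y"] by (simp add: h_def quot_def blinfun.bilinear_simps field_simps)
    qed
  qed simp
  have "f = J p"
  proof (rule blinfun_eqI)
    show "blinfun_apply f y = blinfun_apply (J p) y" for y
      using ge[of y] ge[of "- y"] by (simp add: blinfun.minus_right)
  qed
  then show "\<exists>x. f = J x" by blast
qed

text \<open>Dual counterpart of \<open>power2_norm_midpoint\<close>: \<open>norm m\<close> is the
  dual norm of the midpoint of \<open>J x\<close> and \<open>J y\<close>, while distance is still
  measured between \<open>x\<close> and \<open>y\<close>. Here \<open>phi m x + phi m y\<close> is
  the right-hand side.\<close>

lemma duality_map_midpoint:
  assumes "J m = (1/2) *\<^sub>R (J x + J y)"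
  shows "(norm (x - y))\<^sup>2 / (2 * \<mu>) \<le> (norm x)\<^sup>2 + (norm y)\<^sup>2 - 2 * (norm m)\<^sup>2"
proof -
  have s: "J x + J y = 2 *\<^sub>R J m" using assms by simp
  have "blinfun_apply (J x) m + blinfun_apply (J y) m = 2 * (norm m)\<^sup>2"
    by (simp flip: blinfun.add_left add: s blinfun.scaleR_left duality_map_props)
  then have "phi m x + phi m y = (norm x)\<^sup>2 + (norm y)\<^sup>2 - 2 * (norm m)\<^sup>2"
    by (simp add: phi_def)
  moreover have "(norm (x - y))\<^sup>2 \<le> 2 * (norm (m - x))\<^sup>2 + 2 * (norm (m - y))\<^sup>2"
  proof -
    have "norm (x - y) \<le> norm (m - x) + norm (m - y)"
      using norm_triangle_ineq4[of "m - y" "m - x"] by simp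
    then have "(norm (x - y))\<^sup>2 \<le> (norm (m - x) + norm (m - y))\<^sup>2"
      by (intro power_mono) auto
    also have "\<dots> \<le> 2 * (norm (m - x))\<^sup>2 + 2 * (norm (m - y))\<^sup>2"
      using sum_squares_bound[of "norm (m - x)" "norm (m - y)"] by (simp add: power2_sum)
    finally show ?thesis .
  qed
  then have "(norm (x - y))\<^sup>2 / (2 * \<mu>) \<le> (1 / \<mu>) * (norm (m - x))\<^sup>2 + (1 / \<mu>) * (norm (m - y))\<^sup>2"
    using mu_pos by (simp add: field_simps)
  ultimately show ?thesis
    using phi_ge[of m x] phi_ge[of m y] by linarith
qed

end

section \<open>Maximally monotone graphs and resolvents\<close>

lemma alpha_monotoneD:
  assumes "alpha_monotone \<alpha> T" "u \<in> T x" "v \<in> T y"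
  shows "\<alpha> * blinfun_apply (duality_map x - duality_map y) (x - y) \<le> blinfun_apply (u - v) (x - y)"
  using assms unfolding alpha_monotone_def graph_of_def by blast

context gateaux_smooth_strongly_convex
begin

lemma continuous_on_duality_map_pairing:
  "continuous_on S f \<Longrightarrow> continuous_on S (\<lambda>p. blinfun_apply (J (f p)) y)"
  unfolding continuous_on_def by (blast intro: duality_map_demicontinuous)

text \<open>Writing the dual variable as \<open>J u\<close> moves the minimisation to the complete
  space of pairs \<open>(x, u)\<close>. There the midpoint inequalities, with midpoints taken in
  \<open>x\<close> and in \<open>J u\<close>, give the gap, and demicontinuity of \<open>J\<close>
  gives closed sublevel sets.\<close>

lemma minty:
  fixes T :: "('a \<times> 'a dual) set"
  assumes monotone: "\<And>x u y v. (x, u) \<in> T \<Longrightarrow> (y, v) \<in> T \<Longrightarrow> 0 \<le> blinfun_apply (u - v) (x - y)"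
    and maximal: "\<And>x u. (\<And>y v. (y, v) \<in> T \<Longrightarrow> 0 \<le> blinfun_apply (u - v) (x - y)) \<Longrightarrow> (x, u) \<in> T"
    and "T \<noteq> {}"
  obtains x where "(x, - J x) \<in> T"
proof -
  \<comment> \<open>The supremum of \<open>g y v\<close> over \<open>T\<close> is the Fitzpatrick
    function; it may be infinite, so only the sublevel sets \<open>S c\<close> of its sum with
    \<open>q\<close> are used.\<close>
  define g where "g y v x f = blinfun_apply v x + blinfun_apply f y - blinfun_apply v y"
    for y v x and f :: "'a dual"
  define q where "q p = (norm (fst p))\<^sup>2 / 2 + (norm (snd p))\<^sup>2 / 2" for p :: "'a \<times> 'a"
  define S where "S c = {p. \<forall>(y, v)\<in>T. g y v (fst p) (J (snd p)) + q p \<le> c}" for c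
  have S_I: "p \<in> S c" if "\<And>y v. (y, v) \<in> T \<Longrightarrow> g y v (fst p) (J (snd p)) + q p \<le> c" for p c
    using that by (auto simp: S_def)
  have S_D: "g y v (fst p) (J (snd p)) + q p \<le> c" if "p \<in> S c" "(y, v) \<in> T" for p c y v
    using that by (auto simp: S_def)
  \<comment> \<open>The Fitzpatrick function of a maximally monotone graph dominates the duality pairing.\<close>
  have fitz: "blinfun_apply (J u) x + q (x, u) \<le> c" if S: "(x, u) \<in> S c" for x u c
  proof (cases "(x, J u) \<in> T")
    case True
    from S_D[OF S this] show ?thesis by (simp add: g_def)
  next
    case False
    then obtain y v where yv: "(y, v) \<in> T" "blinfun_apply (J u - v) (x - y) < 0"
      using maximal[of "J u" x] by fastforce
    then show ?thesis
      using S_D[OF S yv(1)] by (simp add: g_def blinfun.bilinear_simps)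
  qed
  have pairing: "- (norm x * norm u) \<le> blinfun_apply (J u) x" for x u
    using duality_map_pairing_le[of u x] by (simp add: mult.commute)
  obtain m p where p: "p \<in> S m" and m: "\<And>c. c < m \<Longrightarrow> S c = {}"
  proof -
    obtain a b where ab: "(a, b) \<in> T" using assms(3) by auto
    obtain u where u: "b = J u" using surj_duality_map by (auto simp: surj_def)
    \<comment> \<open>At a point of \<open>T\<close> monotonicity bounds the Fitzpatrick function by
      the pairing, so some level is nonempty. The lower bound 0 is \<open>fitz\<close> with Young's
      inequality.\<close>
    show thesis
    proof (rule sublevel_minimum[of S "blinfun_apply b a + q (a, u)" 0 "1 / (8 * \<mu>)"])
      have "(a, u) \<in> S (blinfun_apply b a + q (a, u))"
      proof (rule S_I)
        fix y v assume "(y, v) \<in> T"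
        from monotone[OF ab this]
        show "g y v (fst (a, u)) (J (snd (a, u))) + q (a, u) \<le> blinfun_apply b a + q (a, u)"
          by (simp add: g_def u blinfun.bilinear_simps)
      qed
      then show "S (blinfun_apply b a + q (a, u)) \<noteq> {}" by blast
      show "0 \<le> c" if ne: "S c \<noteq> {}" for c
      proof -
        from ne obtain x u where xu: "(x, u) \<in> S c" by fastforce
        have "norm x * norm u \<le> q (x, u)"
          using sum_squares_bound[of "norm x" "norm u"] by (simp add: q_def)
        then show ?thesis using fitz[OF xu] pairing[of x u] by linarith
      qed
      show "closed (S c)" for c
      proof -
        have "S c = (\<Inter>(y, v)\<in>T. {p. g y v (fst p) (J (snd p)) + q p \<le> c})"
          by (auto simp: S_def)
        also have "closed \<dots>"
          unfolding g_def q_def case_prod_beta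
          by (intro closed_INT ballI closed_Collect_le continuous_intros
              continuous_on_duality_map_pairing) auto
        finally show ?thesis .
      qed
      show "p \<in> S c" if "\<And>e. 0 < e \<Longrightarrow> p \<in> S (c + e)" for c p
        by (rule S_I, rule field_le_epsilon) (rule S_D[OF that])
      show "S c \<subseteq> S d" if "c \<le> d" for c d
        by (rule subsetI, rule S_I) (rule order_trans[OF S_D that])
      show "S (c - 1 / (8 * \<mu>) * (dist p p')\<^sup>2) \<noteq> {}" if S: "p \<in> S c" "p' \<in> S c" for c p p'
      proof -
        obtain x u x' u' where xu: "p = (x, u)" "p' = (x', u')" by fastforce
        obtain w where w: "J w = (1/2) *\<^sub>R (J u + J u')"
          using surj_duality_map by (metis surjD)
        define z where "z = (1/2) *\<^sub>R (x + x')"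
        define E where "E = 1 / (8 * \<mu>) * (dist p p')\<^sup>2"
        have "2 * q (z, w) \<le> q p + q p' - 2 * (((norm (x - x'))\<^sup>2 + (norm (u - u'))\<^sup>2) / (8 * \<mu>))"
          using power2_norm_midpoint[of x x'] duality_map_midpoint[OF w] mu_pos
          by (simp add: q_def xu flip: z_def) (simp add: field_simps)
        also have "((norm (x - x'))\<^sup>2 + (norm (u - u'))\<^sup>2) / (8 * \<mu>) = E"
          by (simp add: E_def xu dist_norm norm_Pair)
        finally have qz: "2 * q (z, w) \<le> q p + q p' - 2 * E" .
        have "(z, w) \<in> S (c - E)"
        proof (rule S_I)
          fix y v assume yv: "(y, v) \<in> T"
          have "2 * g y v z (J w) = g y v x (J u) + g y v x' (J u')"
            by (simp add: g_def w z_def blinfun.bilinear_simps field_simps)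
          with S_D[OF S(1) yv] S_D[OF S(2) yv] qz show "g y v (fst (z, w)) (J (snd (z, w))) + q (z, w) \<le> c - E"
            unfolding xu fst_conv snd_conv by linarith
        qed
        then show ?thesis unfolding E_def by blast
      qed
      show "0 < 1 / (8 * \<mu>)" using mu_pos by simp
    qed (rule that)
  qed
  obtain x u where xu: "p = (x, u)" by fastforce
  let ?R = "blinfun_apply (J u) x + blinfun_apply (J x) u + (norm x)\<^sup>2 + (norm u)\<^sup>2"
  \<comment> \<open>First-order optimality of the minimiser \<open>(x, J u)\<close> along the segment towards \<open>(y, v)\<close>.\<close>
  have key: "?R \<le> blinfun_apply (v + J x) (y + u)" if yv: "(y, v) \<in> T" for y v
  proof -
    \<comment> \<open>The dual variable moves along the segment from \<open>J u\<close> to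
      \<open>v\<close>; pulled back by \<open>J\<close> it tends to \<open>u\<close>, because the
      inverse of \<open>J\<close> is Lipschitz.\<close>
    define w where "w t = inv J (J u + t *\<^sub>R (v - J u))" for t
    have Jw: "J (w t) = J u + t *\<^sub>R (v - J u)" for t
      using surj_duality_map by (simp add: w_def surj_f_inv_f)
    have wu: "(w \<longlongrightarrow> u) (at_right 0)"
    proof (rule LIM_zero_cancel, rule Lim_null_comparison)
      show "\<forall>\<^sub>F t in at_right 0. norm (w t - u) \<le> \<mu> * (\<bar>t\<bar> * norm (v - J u))"
        using duality_map_expanding[of "w _" u] by (simp add: Jw)
      show "((\<lambda>t. \<mu> * (\<bar>t\<bar> * norm (v - J u))) \<longlongrightarrow> 0) (at_right 0)"
        by (rule tendsto_eq_intros refl | simp)+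
    qed
    \<comment> \<open>\<open>t * ?D t\<close> bounds the increase of the objective above
      \<open>m\<close> along the segment; the limit of \<open>?D\<close> gives the first-order
      condition.\<close>
    let ?D = "\<lambda>t. blinfun_apply v y - (m - q (x, u)) + quot x (y - x) t + blinfun_apply (v - J u) (w t)"
    have "0 \<le> blinfun_apply v y - (m - q (x, u)) + blinfun_apply (J x) (y - x) + blinfun_apply (v - J u) u"
    proof (rule tendsto_lowerbound)
      show "(?D \<longlongrightarrow> blinfun_apply v y - (m - q (x, u)) + blinfun_apply (J x) (y - x)
          + blinfun_apply (v - J u) u) (at_right 0)"
        by (intro tendsto_intros quot_tendsto wu)
      show "\<forall>\<^sub>F t in at_right 0. 0 \<le> ?D t"
        using eventually_at_right_real[of 0 1]
      proof (rule eventually_mono)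
        fix t :: real assume "t \<in> {0<..<1}"
        then have t: "0 < t" "t < 1" by auto
        define z where "z = x + t *\<^sub>R (y - x)"
        \<comment> \<open>Convexity bound at \<open>(z, w t)\<close>: the Fitzpatrick function is at
          most \<open>m - q (x, u)\<close> at \<open>(x, J u)\<close> and at most the pairing at
          \<open>(y, v)\<close>.\<close>
        define c where "c = (1 - t) * (m - q (x, u)) + t * blinfun_apply v y + q (z, w t)"
        have "(z, w t) \<in> S c"
        proof (rule S_I)
          fix a b assume ab: "(a, b) \<in> T"
          have "g a b z (J (w t)) = (1 - t) * g a b x (J u) + t * g a b y v"
            by (simp add: g_def Jw z_def blinfun.bilinear_simps algebra_simps)
          moreover have "(1 - t) * g a b x (J u) \<le> (1 - t) * (m - q (x, u))"
            using S_D[OF p ab] t by (intro mult_left_mono) (auto simp: xu)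
          moreover have "t * g a b y v \<le> t * blinfun_apply v y"
            using monotone[OF ab yv] t
            by (intro mult_left_mono) (auto simp: g_def blinfun.bilinear_simps)
          ultimately show "g a b (fst (z, w t)) (J (snd (z, w t))) + q (z, w t) \<le> c"
            by (simp add: c_def)
        qed
        then have "m \<le> c" using m[of c] by force
        have "(norm z)\<^sup>2 / 2 = (norm x)\<^sup>2 / 2 + t * quot x (y - x) t"
          using t by (simp add: quot_def z_def field_simps)
        \<comment> \<open>The subgradient inequality of half the squared dual norm at
          \<open>J (w t)\<close>, with subgradient \<open>w t\<close>; it is
          \<open>phi (w t) u \<ge> 0\<close> rewritten.\<close>
        moreover have "(norm (w t))\<^sup>2 / 2 \<le> (norm u)\<^sup>2 / 2 + t * blinfun_apply (v - J u) (w t)"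
        proof -
          have "t * blinfun_apply (v - J u) (w t) = blinfun_apply (J (w t) - J u) (w t)"
            by (simp add: Jw blinfun.scaleR_left)
          also have "\<dots> = (norm (w t))\<^sup>2 - blinfun_apply (J u) (w t)"
            by (simp add: blinfun.diff_left duality_map_props)
          finally show ?thesis
            using phi_nonneg[of "w t" u] by (simp add: phi_def)
        qed
        ultimately have "q (z, w t) \<le> q (x, u) + t * quot x (y - x) t + t * blinfun_apply (v - J u) (w t)"
          unfolding q_def fst_conv snd_conv by linarith
        with \<open>m \<le> c\<close> have "0 \<le> t * ?D t"
          by (simp add: c_def algebra_simps)
        then show "0 \<le> ?D t" using t by (simp add: zero_le_mult_iff)
      qed simp
    qed simp
    moreover have "blinfun_apply (J u) x \<le> m - q (x, u)"
      using fitz[of x u m] p by (simp add: xu)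
    ultimately show ?thesis
      by (simp add: blinfun.bilinear_simps duality_map_props algebra_simps)
  qed
  have "0 \<le> (norm x - norm u)\<^sup>2" by simp
  then have R: "0 \<le> ?R"
    using pairing[of x u] pairing[of u x] by (simp add: power2_diff mult.commute)
  \<comment> \<open>By \<open>key\<close> and \<open>0 \<le> ?R\<close> this point is monotonically
    related to all of \<open>T\<close>. Inserted back into \<open>key\<close> it makes the
    right-hand side vanish, so \<open>?R \<le> 0\<close>.\<close>
  have mem: "(- u, - J x) \<in> T"
  proof (rule maximal)
    fix y v assume "(y, v) \<in> T"
    from key[OF this] R have "0 \<le> blinfun_apply (v + J x) (y + u)" by linarith
    then show "0 \<le> blinfun_apply (- J x - v) (- u - y)"
      by (simp add: blinfun.bilinear_simps algebra_simps)
  qed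
  from key[OF this] have R0: "?R \<le> 0" by simp
  have "(norm x - norm u)\<^sup>2 \<le> ?R"
    using pairing[of x u] pairing[of u x] by (simp add: power2_diff mult.commute)
  then have "(norm x - norm u)\<^sup>2 \<le> 0" using R0 by linarith
  then have "norm u = norm x" by simp
  \<comment> \<open>With equal norms, \<open>?R \<le> 0\<close> forces both pairings to their least
    value, so \<open>- J u\<close> is the norming functional of \<open>x\<close>. Injectivity then
    turns \<open>mem\<close> into the claim.\<close>
  then have "J x = - J u"
    using pairing[of x u] pairing[of u x] R0
    by (intro duality_map_unique)
      (simp_all add: blinfun.minus_left norm_duality_map power2_eq_square)
  then have "x = - u"
    using inj_duality_map by (simp add: inj_eq flip: duality_map_minus)
  then show thesis using that[of x] mem by simp
qed

lemma maximally_monotone_related: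
  fixes A :: "'a \<Rightarrow> 'a dual set"
  assumes A: "maximally_monotone A"
    and rel: "\<And>y v. v \<in> A y \<Longrightarrow> 0 \<le> blinfun_apply (u - v) (x - y)"
  shows "u \<in> A x"
proof -
  let ?S = "A(x := insert u (A x))"
  have mono: "0 \<le> blinfun_apply (v - v') (y - y')" if "v \<in> A y" "v' \<in> A y'" for y y' v v'
    using alpha_monotoneD[of 0 A, OF _ that] A by (simp add: maximally_monotone_def)
  have rel': "0 \<le> blinfun_apply (v - u) (y - x)" if "v \<in> A y" for y v
    using rel[OF that] by (simp add: blinfun.bilinear_simps algebra_simps)
  have "alpha_monotone 0 ?S"
    unfolding alpha_monotone_def graph_of_def
    by (auto simp: mono rel rel' split: if_splits)
  moreover have "graph_of A \<subseteq> graph_of ?S" by (auto simp: graph_of_def)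
  ultimately have "graph_of ?S = graph_of A" using A by (auto simp: maximally_monotone_def)
  then show ?thesis by (auto simp: graph_of_def set_eq_iff split: if_splits)
qed

text \<open>Existence is \<open>minty\<close> for the graph of \<open>l A - w\<close>, where
  membership of \<open>(x, - J x)\<close> reads \<open>w = J x + l a\<close>. Uniqueness is strong
  monotonicity of \<open>J\<close>.\<close>

lemma resolvent_singleton:
  fixes A :: "'a \<Rightarrow> 'a dual set"
  assumes A: "maximally_monotone A" and ne: "graph_of A \<noteq> {}" and l: "0 < l"
  shows "\<exists>!x. \<exists>a\<in>A x. w = J x + l *\<^sub>R a"
proof (rule ex_ex1I)
  have mono: "0 \<le> blinfun_apply (v - v') (y - y')" if "v \<in> A y" "v' \<in> A y'" for y y' v v'
    using alpha_monotoneD[of 0 A, OF _ that] A by (simp add: maximally_monotone_def)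
  define T where "T = {(y, l *\<^sub>R v - w) | y v. v \<in> A y}"
  obtain x where "(x, - J x) \<in> T"
  proof (rule minty[of T])
    show "0 \<le> blinfun_apply (u - v) (x - y)" if "(x, u) \<in> T" "(y, v) \<in> T" for x u y v
    proof -
      obtain u' v' where uv: "u' \<in> A x" "v' \<in> A y" "u = l *\<^sub>R u' - w" "v = l *\<^sub>R v' - w"
        using \<open>(x, u) \<in> T\<close> \<open>(y, v) \<in> T\<close> by (auto simp: T_def)
      have "u - v = l *\<^sub>R (u' - v')" unfolding uv(3,4) by (simp add: algebra_simps)
      then show ?thesis using mono[OF uv(1,2)] l by (simp add: blinfun.scaleR_left)
    qed
    show "T \<noteq> {}" using ne by (auto simp: T_def graph_of_def)
    show "(x, u) \<in> T" if rel: "\<And>y v. (y, v) \<in> T \<Longrightarrow> 0 \<le> blinfun_apply (u - v) (x - y)" for x u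
    proof -
      have "(u + w) /\<^sub>R l \<in> A x"
      proof (rule maximally_monotone_related[OF A])
        fix y v assume "v \<in> A y"
        then have "0 \<le> blinfun_apply (u - (l *\<^sub>R v - w)) (x - y)"
          by (intro rel) (auto simp: T_def)
        also have "u - (l *\<^sub>R v - w) = l *\<^sub>R ((u + w) /\<^sub>R l - v)"
          using l by (simp add: algebra_simps)
        finally show "0 \<le> blinfun_apply ((u + w) /\<^sub>R l - v) (x - y)"
          using l by (simp add: blinfun.scaleR_left zero_le_mult_iff)
      qed
      moreover have "u = l *\<^sub>R ((u + w) /\<^sub>R l) - w" using l by simp
      ultimately show ?thesis unfolding T_def by blast
    qed
  qed
  then show "\<exists>x. \<exists>a\<in>A x. w = J x + l *\<^sub>R a"
    by (force simp: T_def algebra_simps)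
  show "x = y" if xy: "\<exists>a\<in>A x. w = J x + l *\<^sub>R a" "\<exists>b\<in>A y. w = J y + l *\<^sub>R b" for x y
  proof -
    obtain a b where ab: "a \<in> A x" "b \<in> A y" "w = J x + l *\<^sub>R a" "w = J y + l *\<^sub>R b"
      using xy by blast
    then have "J x - J y = (- l) *\<^sub>R (a - b)"
      by (simp add: algebra_simps)
    then have "blinfun_apply (J x - J y) (x - y) \<le> 0"
      using mono[OF ab(1,2)] l by (simp only: blinfun.scaleR_left) (simp add: zero_le_mult_iff)
    then have "(1 / \<mu>) * (norm (x - y))\<^sup>2 \<le> 0"
      using duality_map_strongly_monotone[of x y] by linarith
    then show "x = y" using mu_pos by (simp add: field_simps mult_le_0_iff)
  qed
qed

text \<open>Turns \<open>the_elem\<close> into an inclusion; \<open>inv J\<close> cancels against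
  the \<open>J\<close> inside \<open>resolvent\<close>.\<close>

lemma resolvent_inclusion:
  fixes A :: "'a \<Rightarrow> 'a dual set"
  assumes "maximally_monotone A" "graph_of A \<noteq> {}" "0 < l"
  obtains a where "a \<in> A ((resolvent A l \<circ> inv J) w)" "w = J ((resolvent A l \<circ> inv J) w) + l *\<^sub>R a"
proof -
  let ?Q = "op_inverse (op_plus (op_of_fun J) (op_scale l A)) w"
  have Q: "?Q = {x. \<exists>a\<in>A x. w = J x + l *\<^sub>R a}"
    by (auto simp: op_inverse_def op_plus_def op_of_fun_def op_scale_def)
  obtain x where x: "?Q = {x}"
    using resolvent_singleton[OF assms, of w] unfolding Q by blast
  have "(resolvent A l \<circ> inv J) w = x"
    by (simp add: resolvent_def surj_f_inv_f[OF surj_duality_map] x)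
  then show thesis using that x Q by blast
qed

end

section \<open>Geometric decay along the iteration\<close>

lemma R_linear_convergence_tendsto:
  assumes "R_linear_convergence x l"
  shows "x \<longlonglongrightarrow> l"
proof -
  obtain M q where q: "q \<in> {0<..<1}" and le: "\<And>n. norm (x n - l) \<le> M * q ^ n"
    using assms unfolding R_linear_convergence_def by blast
  have "(\<lambda>n. M * q ^ n) \<longlonglongrightarrow> 0"
    using tendsto_mult_right_zero[OF LIMSEQ_power_zero[of q]] q by simp
  moreover have "\<forall>\<^sub>F n in sequentially. norm (x n - l) \<le> M * q ^ n"
    using le by simp
  ultimately have "(\<lambda>n. x n - l) \<longlonglongrightarrow> 0"
    by (rule Lim_null_comparison[rotated])
  then show ?thesis
    by (rule LIM_zero_cancel)
qed

lemma contraction_geometric: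
  fixes V :: "nat \<Rightarrow> real"
  assumes c: "0 < c" and step: "\<And>n. (1 + c) * V (Suc n) \<le> V n"
  shows "V n \<le> V 0 * (1 / (1 + c)) ^ n"
proof (induction n)
  case (Suc n)
  have "V (Suc n) \<le> V n / (1 + c)"
    using step[of n] c by (simp add: field_simps)
  also have "\<dots> \<le> (V 0 * (1 / (1 + c)) ^ n) / (1 + c)"
    using Suc c by (intro divide_right_mono) auto
  finally show ?case by simp
qed simp

text \<open>Young's inequality, with the Lipschitz constant and the step size \<open>l\<close>
  absorbed into the single constant \<open>k\<close>.\<close>

lemma two_mult_blinfun_le:
  fixes f :: "'a::real_normed_vector dual"
  assumes "norm f \<le> L * d" "0 \<le> l" "l * L \<le> k" "0 \<le> d" "0 \<le> k"
  shows "\<bar>2 * l * blinfun_apply f y\<bar> \<le> k * (d\<^sup>2 + (norm y)\<^sup>2)"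
proof -
  have "\<bar>2 * l * blinfun_apply f y\<bar> = 2 * (l * \<bar>blinfun_apply f y\<bar>)"
    using assms(2) by (simp add: abs_mult)
  also have "l * \<bar>blinfun_apply f y\<bar> \<le> l * (norm f * norm y)"
    using norm_blinfun[of f y] assms(2) by (intro mult_left_mono) auto
  also have "\<dots> \<le> l * ((L * d) * norm y)"
    using assms by (intro mult_left_mono mult_right_mono) auto
  also have "\<dots> = (l * L) * (d * norm y)" by simp
  also have "2 * \<dots> = (l * L) * (2 * d * norm y)" by simp
  also have "\<dots> \<le> k * (2 * d * norm y)"
    using assms by (intro mult_right_mono) auto
  also have "\<dots> \<le> k * (d\<^sup>2 + (norm y)\<^sup>2)"
    using sum_squares_bound[of d "norm y"] assms by (intro mult_left_mono) auto
  finally show ?thesis by simp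
qed

context gateaux_smooth_strongly_convex
begin

text \<open>
  One step \<open>x0, x1 \<mapsto> x2\<close> of the iteration, with \<open>b0, b1, b2\<close> the values of \<open>B\<close> there and \<open>a\<close> the
  element of \<open>A x2\<close> selected by the resolvent.
\<close>
lemma forward_reflected_backward_step:
  fixes x0 x1 x2 z :: 'a and a b0 b1 b2 :: "'a dual"
  assumes iter: "J x1 - l1 *\<^sub>R b1 - l0 *\<^sub>R (b1 - b0) = J x2 + l1 *\<^sub>R a"
    and strong: "s * blinfun_apply (J x2 - J z) (x2 - z) \<le> blinfun_apply (a + b2) (x2 - z)"
    and lip: "norm (b1 - b0) \<le> L * norm (x1 - x0)"
    and "0 \<le> l0" "l0 * L \<le> k" "0 \<le> k" "0 \<le> l1" "0 \<le> s"
  shows "phi z x2 - 2 * l1 * blinfun_apply (b2 - b1) (x2 - z) + (1 / \<mu> - k) * (norm (x2 - x1))\<^sup>2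
      + l1 * s * phi z x2
    \<le> phi z x1 - 2 * l0 * blinfun_apply (b1 - b0) (x1 - z) + k * (norm (x1 - x0))\<^sup>2"
proof -
  \<comment> \<open>Dropping \<open>phi x2 z\<close> from the symmetrised identity lets the
    monotonicity constant \<open>s\<close> act on \<open>phi z x2\<close> alone.\<close>
  have "phi z x2 \<le> 2 * blinfun_apply (J x2 - J z) (x2 - z)"
    using phi_symmetrized[of x2 z] phi_nonneg[of x2 z] by simp
  then have "l1 * s * phi z x2 \<le> l1 * s * (2 * blinfun_apply (J x2 - J z) (x2 - z))"
    using assms by (intro mult_left_mono) auto
  also have "\<dots> \<le> 2 * (l1 * blinfun_apply (a + b2) (x2 - z))"
    using mult_left_mono[OF strong \<open>0 \<le> l1\<close>] by (simp add: mult_ac)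
  also have "l1 * blinfun_apply (a + b2) (x2 - z) = blinfun_apply (l1 *\<^sub>R a + l1 *\<^sub>R b2) (x2 - z)"
    by (simp add: blinfun.bilinear_simps algebra_simps)
  also have "l1 *\<^sub>R a = J x1 - J x2 - l1 *\<^sub>R b1 - l0 *\<^sub>R (b1 - b0)"
    using iter by (simp add: algebra_simps)
  \<comment> \<open>Splitting \<open>x2 - z\<close> as \<open>(x1 - z) + (x2 - x1)\<close> in the
    reflected term leaves a telescoping part and an error controlled by step lengths.\<close>
  also have "blinfun_apply (J x1 - J x2 - l1 *\<^sub>R b1 - l0 *\<^sub>R (b1 - b0) + l1 *\<^sub>R b2) (x2 - z)
      = blinfun_apply (J x1 - J x2) (x2 - z) + l1 * blinfun_apply (b2 - b1) (x2 - z)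
        - l0 * blinfun_apply (b1 - b0) (x1 - z) - l0 * blinfun_apply (b1 - b0) (x2 - x1)"
    by (simp add: blinfun.bilinear_simps algebra_simps)
  finally have "l1 * s * phi z x2 \<le> (phi z x1 - phi z x2 - phi x2 x1)
      + 2 * l1 * blinfun_apply (b2 - b1) (x2 - z) - 2 * l0 * blinfun_apply (b1 - b0) (x1 - z)
      - 2 * l0 * blinfun_apply (b1 - b0) (x2 - x1)"
    by (simp add: phi_three_point)
  moreover have "\<bar>2 * l0 * blinfun_apply (b1 - b0) (x2 - x1)\<bar>
      \<le> k * ((norm (x1 - x0))\<^sup>2 + (norm (x2 - x1))\<^sup>2)"
    using assms by (intro two_mult_blinfun_le[where L = L]) auto
  ultimately show ?thesis
    using phi_ge[of x2 x1] by (simp add: algebra_simps)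
qed

text \<open>The limit is any prescribed zero \<open>z\<close>. Each step leaves a surplus in
  \<open>phi z (x (n + 1))\<close> and in the last squared step length; together they dominate a
  fixed multiple of \<open>V\<close>, which hence decays geometrically and controls the squared
  distance to \<open>z\<close>.\<close>

lemma forward_reflected_backward_R_linear:
  fixes A :: "'a \<Rightarrow> 'a dual set" and B :: "'a \<Rightarrow> 'a dual" and lam :: "int \<Rightarrow> real" and x :: "int \<Rightarrow> 'a"
  assumes A: "maximally_monotone A" "alpha_monotone \<alpha> A"
    and B: "alpha_monotone \<beta> (op_of_fun B)" "L-lipschitz_on UNIV B" "0 < L"
    and pos: "0 < \<alpha> + \<beta>" "0 < \<epsilon>"
    and lam: "\<And>n. - 1 \<le> n \<Longrightarrow> lam n \<in> {\<epsilon>..(1 - 2 * \<epsilon>) / (2 * \<mu> * L)}"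
    and iter: "\<And>n. 0 \<le> n \<Longrightarrow> x (n + 1) = (resolvent A (lam n) \<circ> inv J)
        (J (x n) - lam n *\<^sub>R B (x n) - lam (n - 1) *\<^sub>R (B (x n) - B (x (n - 1))))"
    and z: "z \<in> op_inverse (op_plus A (op_of_fun B)) 0"
  shows "R_linear_convergence (\<lambda>n. x (int n)) z"
proof -
  \<comment> \<open>Upper bound for \<open>lam n * L\<close>; it leaves
    \<open>1 / \<mu> - 2 * k = 2 * \<epsilon> / \<mu>\<close> as surplus coefficient of the squared
    step length.\<close>
  define k where "k = (1 - 2 * \<epsilon>) / (2 * \<mu>)"
  define s where "s = \<alpha> + \<beta>"
  have lam_bounds: "\<epsilon> \<le> lam n" "0 < lam n" "lam n * L \<le> k" if "- 1 \<le> n" for n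
  proof -
    show "\<epsilon> \<le> lam n" "0 < lam n" using lam[OF that] pos by auto
    have "lam n * L \<le> (1 - 2 * \<epsilon>) / (2 * \<mu> * L) * L"
      using lam[OF that] B(3) by (intro mult_right_mono) auto
    then show "lam n * L \<le> k" using B(3) by (simp add: k_def)
  qed
  \<comment> \<open>The step-size interval contains \<open>lam 0\<close>, which forces \<epsilon> <
    1/2.\<close>
  have k: "0 < k"
    using mult_pos_pos[OF lam_bounds(2)[of 0] B(3)] lam_bounds(3)[of 0] by simp
  have k2: "1 / \<mu> - k = k + 2 * \<epsilon> / \<mu>" "k * \<mu> \<le> 1 / 2"
    using mu_pos pos by (simp_all add: k_def field_simps)
  have lip: "norm (B u - B v) \<le> L * norm (u - v)" for u v
    using lipschitz_onD[OF B(2)] by (simp add: dist_norm)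
  have az: "- B z \<in> A z"
    using z by (auto simp: op_inverse_def op_plus_def op_of_fun_def dest: eq_neg_iff_add_eq_0[THEN iffD2])
  then have ne: "graph_of A \<noteq> {}" by (auto simp: graph_of_def)
  have strong: "s * blinfun_apply (J y - J z) (y - z) \<le> blinfun_apply (a + B y) (y - z)"
    if "a \<in> A y" for a y
  proof -
    have "\<alpha> * blinfun_apply (J y - J z) (y - z) \<le> blinfun_apply (a - (- B z)) (y - z)"
      by (rule alpha_monotoneD[OF A(2) that az])
    moreover have "\<beta> * blinfun_apply (J y - J z) (y - z) \<le> blinfun_apply (B y - B z) (y - z)"
      by (rule alpha_monotoneD[OF B(1)]) (simp_all add: op_of_fun_def)
    ultimately show ?thesis
      by (simp add: s_def blinfun.bilinear_simps algebra_simps)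
  qed
  define D where "D n = phi z (x n)" for n
  define d where "d n = (norm (x n - x (n - 1)))\<^sup>2" for n
  define C where "C n = 2 * lam (n - 1) * blinfun_apply (B (x n) - B (x (n - 1))) (x n - z)" for n
  define V where "V n = D n - C n + k * d n" for n
  have C_le: "\<bar>C n\<bar> \<le> k * d n + D n / 2" if "0 \<le> n" for n
  proof -
    have "\<bar>C n\<bar> \<le> k * (d n + (norm (x n - z))\<^sup>2)"
      unfolding C_def d_def
    proof (rule two_mult_blinfun_le[OF lip])
      \<comment> \<open>For \<open>n = 0\<close> this is the bound on
        \<open>lam (- 1)\<close>.\<close>
      show "0 \<le> lam (n - 1)" "lam (n - 1) * L \<le> k"
        using lam_bounds[of "n - 1"] that by simp_all
    qed (use k in simp_all)
    moreover have "(norm (x n - z))\<^sup>2 \<le> \<mu> * D n"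
      using phi_ge[of z "x n"] mu_pos by (simp add: D_def norm_minus_commute field_simps)
    then have "k * (norm (x n - z))\<^sup>2 \<le> k * (\<mu> * D n)"
      using k by (intro mult_left_mono) auto
    moreover have "(k * \<mu>) * D n \<le> 1 / 2 * D n"
      using k2(2) phi_nonneg by (intro mult_right_mono) (auto simp: D_def)
    ultimately show ?thesis by (simp add: algebra_simps)
  qed
  have D_nonneg: "0 \<le> D n" and d_nonneg: "0 \<le> d n" for n
    by (auto simp: D_def d_def phi_nonneg)
  have V_ge: "D n \<le> 2 * V n" if "0 \<le> n" for n
    using C_le[OF that] by (simp add: V_def abs_le_iff)
  have V_le: "V n \<le> 3 / 2 * D n + 2 * k * d n" if "0 \<le> n" for n
    using C_le[OF that] by (simp add: V_def abs_le_iff)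
  \<comment> \<open>The two entries let \<open>c\<close> times the upper bound \<open>V_le\<close>
    be absorbed by the surplus terms in \<open>D\<close> and in \<open>d\<close>,
    respectively.\<close>
  define c where "c = min (2 * (\<epsilon> * s) / 3) (\<epsilon> / (\<mu> * k))"
  have s_pos: "0 < s" using pos by (simp add: s_def)
  have c: "0 < c" using s_pos pos k mu_pos by (simp add: c_def)
  have step: "(1 + c) * V (n + 1) \<le> V n" if n: "0 \<le> n" for n
  proof -
    have "0 < lam n" using lam_bounds(2)[of n] n by simp
    then obtain a where a: "a \<in> A (x (n + 1))" "J (x n) - lam n *\<^sub>R B (x n)
        - lam (n - 1) *\<^sub>R (B (x n) - B (x (n - 1))) = J (x (n + 1)) + lam n *\<^sub>R a"
      unfolding iter[OF n] by (rule resolvent_inclusion[OF A(1) ne])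
    have "D (n + 1) - C (n + 1) + (1 / \<mu> - k) * d (n + 1) + lam n * s * D (n + 1) \<le> V n"
      using forward_reflected_backward_step[OF a(2) strong[OF a(1)] lip, of k]
        lam_bounds[of n] lam_bounds(2,3)[of "n - 1"] n k s_pos
      by (simp add: V_def D_def C_def d_def)
    moreover have "(\<epsilon> * s) * D (n + 1) \<le> (lam n * s) * D (n + 1)"
      using lam_bounds(1)[of n] n s_pos D_nonneg by (intro mult_right_mono) auto
    moreover have "c * V (n + 1) \<le> (\<epsilon> * s) * D (n + 1) + 2 * \<epsilon> / \<mu> * d (n + 1)"
    proof -
      have "c * V (n + 1) \<le> c * (3 / 2 * D (n + 1) + 2 * k * d (n + 1))"
        using V_le[of "n + 1"] n c by (intro mult_left_mono) auto
      also have "\<dots> = (c * (3 / 2)) * D (n + 1) + (c * (2 * k)) * d (n + 1)"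
        by (simp add: algebra_simps)
      also have "\<dots> \<le> (\<epsilon> * s) * D (n + 1) + (2 * \<epsilon> / \<mu>) * d (n + 1)"
      proof (intro add_mono mult_right_mono D_nonneg d_nonneg)
        show "c * (3 / 2) \<le> \<epsilon> * s" by (simp add: c_def min_def field_simps)
        have "c * (2 * k) \<le> \<epsilon> / (\<mu> * k) * (2 * k)"
          using k by (intro mult_right_mono) (auto simp: c_def)
        then show "c * (2 * k) \<le> 2 * \<epsilon> / \<mu>" using k by (simp add: mult.commute)
      qed
      finally show ?thesis .
    qed
    ultimately show ?thesis
      by (simp add: V_def k2(1) algebra_simps)
  qed
  define r where "r = sqrt (1 / (1 + c))"
  define M where "M = sqrt (2 * \<mu> * V 0)"
  have V_geom: "V (int n) \<le> V 0 * (1 / (1 + c)) ^ n" for n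
  proof -
    have "V (int n) \<le> V (int 0) * (1 / (1 + c)) ^ n"
    proof (rule contraction_geometric[of c "\<lambda>n. V (int n)", OF c])
      show "(1 + c) * V (int (Suc n)) \<le> V (int n)" for n
        using step[of "int n"] by (simp add: add.commute)
    qed
    then show ?thesis by simp
  qed
  have "norm (x (int n) - z) \<le> M * r ^ n" for n
  proof (rule power2_le_imp_le)
    have "(norm (x (int n) - z))\<^sup>2 \<le> \<mu> * D (int n)"
      using phi_ge[of z "x (int n)"] mu_pos by (simp add: D_def norm_minus_commute field_simps)
    also have "\<dots> \<le> \<mu> * (2 * (V 0 * (1 / (1 + c)) ^ n))"
      using V_ge[of "int n"] V_geom[of n] mu_pos by (intro mult_left_mono) auto
    also have "\<dots> = (M * r ^ n)\<^sup>2"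
    proof -
      have "0 \<le> V 0" using V_ge[of 0] D_nonneg[of 0] by simp
      then have "M\<^sup>2 = 2 * \<mu> * V 0" using mu_pos by (simp add: M_def)
      moreover have "(r ^ n)\<^sup>2 = (r\<^sup>2) ^ n" by (simp flip: power_mult add: mult.commute)
      moreover have "r\<^sup>2 = 1 / (1 + c)" using c by (simp add: r_def)
      ultimately show ?thesis by (simp add: power_mult_distrib)
    qed
    finally show "(norm (x (int n) - z))\<^sup>2 \<le> (M * r ^ n)\<^sup>2" .
    have "0 \<le> V 0" using V_ge[of 0] D_nonneg[of 0] by simp
    then show "0 \<le> M * r ^ n" using mu_pos c by (simp add: M_def r_def)
  qed
  moreover have "0 \<le> M"
    using V_ge[of 0] D_nonneg[of 0] mu_pos by (simp add: M_def)
  moreover have "r \<in> {0<..<1}" using c by (simp add: r_def)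
  ultimately show ?thesis
    unfolding R_linear_convergence_def by blast
qed

end

theorem theorem4p1:
  fixes A :: "'a::banach \<Rightarrow> 'a dual set"
    and B :: "'a \<Rightarrow> 'a dual"
    and \<mu> \<alpha> \<beta> L \<epsilon> :: real
    and lam :: "int \<Rightarrow> real"
    and x :: "int \<Rightarrow> 'a"
  assumes "two_uniformly_convex TYPE('a)"
    and "uniformly_smooth TYPE('a)"
    and "\<mu> \<ge> 1"
    and "\<And>y z :: 'a. (1 / \<mu>) * (norm (y - z))\<^sup>2 \<le> phi y z"
    and "\<alpha> + \<beta> > 0"
    and "maximally_monotone A"
    and "alpha_monotone \<alpha> A"
    and "alpha_monotone \<beta> (op_of_fun B)"
    and "L > 0"
    and "L-lipschitz_on UNIV B"
    and "0 < \<epsilon>" and "\<epsilon> < \<alpha> + \<beta>"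
    and "\<And>n. n \<ge> -1 \<Longrightarrow> lam n \<in> {\<epsilon>..(1 - 2 * \<epsilon>) / (2 * \<mu> * L)}"
    and "\<And>n. n \<ge> 0 \<Longrightarrow> x (n + 1) =
           (resolvent A (lam n) \<circ> inv duality_map)
             (duality_map (x n) - lam n *\<^sub>R B (x n)
                - lam (n - 1) *\<^sub>R (B (x n) - B (x (n - 1))))"
    and "op_inverse (op_plus A (op_of_fun B)) 0 \<noteq> {}"
  shows "\<exists>xs \<in> op_inverse (op_plus A (op_of_fun B)) 0.
           (\<lambda>n. x (int n)) \<longlonglongrightarrow> xs \<and> R_linear_convergence (\<lambda>n. x (int n)) xs"
proof -
  interpret gateaux_smooth_strongly_convex "TYPE('a)" \<mu>
    using uniformly_smooth_power2_norm[OF assms(2)] assms(3,4) by unfold_locales auto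
  obtain z where z: "z \<in> op_inverse (op_plus A (op_of_fun B)) 0"
    using assms(15) by blast
  have "R_linear_convergence (\<lambda>n. x (int n)) z"
    using assms(13,14) z
    by (rule forward_reflected_backward_R_linear[OF assms(6-8,10,9,5,11), where lam = lam])
  then show ?thesis
    using z R_linear_convergence_tendsto by blast
qed

end
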